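(* Let $j\geqslant1$, let $u$ be a finite word over $\{{\tt a},{\tt b}\}$ of length $2j$ containing exactly $j$ letters ${\tt a}$ and $j$ letters ${\tt b}$, and let ${\tt w}_j=u{\tt f}$ be the word obtained from the Fibonacci word ${\tt f}$ by attaching the prefix $u$. Then $r_{{\tt w}_j}(n)=n-j$ for all $n>j$. Moreover, if $u=({\tt a}{\tt b})^j$, then $r_{{\tt w}_j}(1)=r_{{\tt w}_j}(2)=\cdots=r_{{\tt w}_j}(j)=1$.
   Context: The Fibonacci word ${\tt f}$ is the fixed point of $\varrho_F:{\tt a}\mapsto{\tt a}{\tt b},\ {\tt b}\mapsto{\tt a}$. Words are indexed from position $0$; $p_{\tt a}(n)$, $p_{\tt b}(n)$ are the positions of the $n$-th ${\tt a}$ and $n$-th ${\tt b}$ and $r(n)=p_{\tt b}(n)-p_{\tt a}(n)$. *)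

theory Defs
  imports Main "HOL-Library.Stream" "HOL-Library.Infinite_Set" "HOL-Library.Sublist"
begin

datatype letter = La | Lb

fun fib_subst :: "letter \<Rightarrow> letter list" where
  "fib_subst La = [La, Lb]"
| "fib_subst Lb = [La]"

definition subst_inf :: "(letter \<Rightarrow> letter list) \<Rightarrow> letter stream \<Rightarrow> letter stream" where
  "subst_inf \<rho> w = flat (smap \<rho> w)"

text \<open>The description is proper: see \<open>fib_word_ex1\<close> below.\<close>

definition fib_word :: "letter stream" where
  "fib_word = (THE w. subst_inf fib_subst w = w)"

text \<open>
  Occurrences are counted from \<open>1\<close>, positions from \<open>0\<close>, while \<^const>\<open>enumerate\<close> counts
  from \<open>0\<close>. The value at \<open>n = 0\<close>, or for \<open>n\<close> exceeding the number of occurrences, is meaningless.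
\<close>

definition occ_pos :: "letter \<Rightarrow> letter stream \<Rightarrow> nat \<Rightarrow> nat" where
  "occ_pos x w n = enumerate {i. w !! i = x} (n - 1)"

definition pos_diff :: "letter stream \<Rightarrow> nat \<Rightarrow> int" where
  "pos_diff w n = int (occ_pos Lb w n) - int (occ_pos La w n)"

lemma fib_subst_nonempty: "fib_subst x \<noteq> []"
  by (cases x) auto

lemma subst_inf_shift:
  "subst_inf fib_subst (u @- s) = concat (map fib_subst u) @- subst_inf fib_subst s"
  by (induction u) (auto simp: subst_inf_def fib_subst_nonempty)

definition fib_iter :: "nat \<Rightarrow> letter list" where
  "fib_iter n = ((\<lambda>u. concat (map fib_subst u)) ^^ n) [La]"

lemma fib_iter_0: "fib_iter 0 = [La]"
  and fib_iter_Suc: "fib_iter (Suc n) = concat (map fib_subst (fib_iter n))"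
  by (simp_all add: fib_iter_def)

lemma fib_iter_prefix_Suc: "prefix (fib_iter n) (fib_iter (Suc n))"
proof (induction n)
  case 0
  show ?case by (simp add: fib_iter_Suc fib_iter_0)
next
  case (Suc n)
  then obtain v where "fib_iter (Suc n) = fib_iter n @ v" by (auto simp: prefix_def)
  then have "fib_iter (Suc (Suc n)) = fib_iter (Suc n) @ concat (map fib_subst v)"
    by (simp add: fib_iter_Suc[of "Suc n"]) (simp add: fib_iter_Suc)
  then show ?case by (simp add: prefix_def)
qed

lemma fib_iter_prefix: "m \<le> n \<Longrightarrow> prefix (fib_iter m) (fib_iter n)"
proof (induction n rule: dec_induct)
  case (step n)
  then show ?case using fib_iter_prefix_Suc[of n] by (meson prefix_order.trans)
qed simp

lemma length_fib_iter: "n < length (fib_iter n)"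
proof (induction n)
  case (Suc n)
  have la: "La \<in> set (fib_iter n)"
    using fib_iter_prefix[of 0 n] by (auto simp: fib_iter_0 prefix_def)
  have ge: "length xs \<le> length (concat (map fib_subst xs))" for xs
  proof (induction xs)
    case (Cons x xs)
    then show ?case by (cases x) auto
  qed simp
  have "La \<in> set xs \<Longrightarrow> length xs < length (concat (map fib_subst xs))" for xs
  proof (induction xs)
    case (Cons x xs)
    then show ?case using ge[of xs] by (cases x) auto
  qed simp
  from this[OF la] Suc show ?case by (simp add: fib_iter_Suc)
qed (simp add: fib_iter_0)

lemma eq_if_fib_iter_prefixes:
  assumes "\<And>n. \<exists>s'. s = fib_iter n @- s'" "\<And>n. \<exists>t'. t = fib_iter n @- t'"
  shows "s = t"
proof -
  have "s !! n = t !! n" for n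
  proof -
    obtain s' t' where "s = fib_iter n @- s'" "t = fib_iter n @- t'"
      using assms by metis
    then show ?thesis using length_fib_iter[of n] by simp
  qed
  then show ?thesis by (metis smap_alt stream.map_ident)
qed

lemma fib_word_ex1: "\<exists>!w. subst_inf fib_subst w = w"
proof -
  define w where "w = smap (\<lambda>k. fib_iter k ! k) nats"
  have w: "\<exists>s. w = fib_iter n @- s" for n
  proof -
    have "w !! i = fib_iter n ! i" if "i < length (fib_iter n)" for i
    proof (cases "i \<le> n")
      case True
      then obtain v where "fib_iter n = fib_iter i @ v"
        using fib_iter_prefix by (auto simp: prefix_def)
      then show ?thesis using length_fib_iter[of i] by (simp add: w_def nth_append)
    next
      case False
      then obtain v where "fib_iter i = fib_iter n @ v"
        using fib_iter_prefix[of n i] by (auto simp: prefix_def)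
      then show ?thesis using that by (simp add: w_def nth_append)
    qed
    then have "stake (length (fib_iter n)) w = fib_iter n"
      by (intro nth_equalityI) auto
    then show ?thesis by (metis stake_sdrop)
  qed
  have "\<exists>s. subst_inf fib_subst w = fib_iter n @- s" for n
  proof -
    obtain s where "w = fib_iter n @- s" using w by blast
    then have "subst_inf fib_subst w = fib_iter (Suc n) @- subst_inf fib_subst s"
      by (simp add: subst_inf_shift fib_iter_Suc)
    moreover obtain v where "fib_iter (Suc n) = fib_iter n @ v"
      using fib_iter_prefix_Suc by (auto simp: prefix_def)
    ultimately show ?thesis by auto
  qed
  then have fix_w: "subst_inf fib_subst w = w"
    using w by (intro eq_if_fib_iter_prefixes)
  have "v = w" if v: "subst_inf fib_subst v = v" for v
  proof -
    have "\<exists>s. v = fib_iter n @- s" for n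
    proof (induction n)
      case 0
      have "shd (subst_inf fib_subst v) = La"
        by (cases "shd v") (simp_all add: subst_inf_def)
      then have "shd v = La" using v by simp
      then show ?case
        by (metis fib_iter_0 shift.simps stream.collapse)
    next
      case (Suc n)
      then obtain s where "v = fib_iter n @- s" by blast
      then have "subst_inf fib_subst v = fib_iter (Suc n) @- subst_inf fib_subst s"
        by (simp add: subst_inf_shift fib_iter_Suc)
      then show ?case using v by auto
    qed
    then show ?thesis using w by (rule eq_if_fib_iter_prefixes)
  qed
  with fix_w show ?thesis by blast
qed

lemma fib_word_fixed: "subst_inf fib_subst fib_word = fib_word"
  unfolding fib_word_def by (rule theI'[OF fib_word_ex1])

end

theory Submission
  imports Defs
begin

text \<open>
  Cut the Fibonacci word before its \<open>n\<close>-th \<open>a\<close>, so that the prefix \<open>v\<close> contains \<open>n - 1\<close> letters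
  \<open>a\<close>. Applying the substitution to this factorization gives another factorization of the same
  word: the image of \<open>v\<close> has length \<open>|v| + n - 1\<close>, contains \<open>n - 1\<close> letters \<open>b\<close> and is followed
  by \<open>ab\<close>. Hence the \<open>n\<close>-th \<open>b\<close> is at position \<open>|v| + n\<close>, which is \<open>n\<close> more than the position of
  the \<open>n\<close>-th \<open>a\<close>. A balanced prefix \<open>u\<close> moves both letters by the same amount and
  raises their occurrence number by \<open>j\<close>.
\<close>

text \<open>Deleting the least element lowers the count below \<open>m\<close> by one, until
  \<open>m\<close> itself is the least. \<open>S\<close> may be finite, so occurrences need not be
  shown to be infinite in number.\<close>

lemma enumerate_eqI:
  fixes S :: "nat set"
  assumes "m \<in> S" "card {i \<in> S. i < m} = n"
  shows "enumerate S n = m"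
  using assms
proof (induction n arbitrary: S)
  case 0
  then have "{i \<in> S. i < m} = {}" by simp
  then have "(LEAST i. i \<in> S) = m"
    using 0 by (intro Least_equality) (auto simp: not_less[symmetric])
  then show ?case by (simp add: enumerate_0)
next
  case (Suc n)
  let ?l = "enumerate S 0"
  have "{i \<in> S. i < m} \<noteq> {}" using Suc.prems by (metis card.empty nat.distinct(1))
  then obtain i where "i \<in> S" "i < m" by blast
  then have l: "?l \<in> S" "?l < m"
    by (auto simp: enumerate_0 intro: LeastI le_less_trans[OF Least_le])
  have "{i \<in> S - {?l}. i < m} = {i \<in> S. i < m} - {?l}" by blast
  then have "card {i \<in> S - {?l}. i < m} = n"
    using Suc.prems l by simp
  then show ?case
    using Suc.IH[of "S - {?l}"] Suc.prems l by (simp only: enumerate_Suc') simp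
qed

lemma occ_pos_shift_Stream: "occ_pos x (v @- x ## t) (Suc (count_list v x)) = length v"
proof -
  let ?w = "v @- x ## t"
  have "{i \<in> {i. ?w !! i = x}. i < length v} = {i. i < length v \<and> v ! i = x}"
    by auto
  then have "card {i \<in> {i. ?w !! i = x}. i < length v} = count_list v x"
    by (simp add: count_list_eq_length_filter length_filter_conv_card eq_commute)
  then show ?thesis
    unfolding occ_pos_def by (intro enumerate_eqI) simp_all
qed

lemma count_list_concat_fib_subst:
  "count_list (concat (map fib_subst v)) La = length v"
  "count_list (concat (map fib_subst v)) Lb = count_list v La"
  "length (concat (map fib_subst v)) = length v + count_list v La"
proof (induction v)
  case (Cons x v)
  { case 1 show ?case using Cons by (cases x) auto }
  { case 2 show ?case using Cons by (cases x) auto }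
  { case 3 show ?case using Cons by (cases x) auto }
qed auto

lemma fib_word_eq_subst_shift:
  assumes "fib_word = v @- s"
  shows "fib_word = concat (map fib_subst v) @- subst_inf fib_subst s"
  using fib_word_fixed assms by (metis subst_inf_shift)

text \<open>Every letter has an image that starts with \<open>La\<close> and contains no other
  \<open>La\<close>. So the image of the prefix of length \<open>n\<close> contains
  \<open>La\<close> exactly \<open>n\<close> times, and the image of the next letter supplies the
  \<open>La\<close> after the cut.\<close>

lemma fib_word_split_La:
  obtains v t where "fib_word = v @- La ## t" "count_list v La = n"
proof -
  let ?v = "concat (map fib_subst (stake n fib_word))"
  let ?s = "subst_inf fib_subst (sdrop n fib_word)"
  have "fib_word = ?v @- ?s"
    by (rule fib_word_eq_subst_shift) (simp add: stake_sdrop)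
  moreover have "shd ?s = La"
    by (cases "fib_word !! n") (simp_all add: subst_inf_def)
  then have "?s = La ## stl ?s" by (metis stream.collapse)
  ultimately show thesis
    using that[of ?v "stl ?s"] by (simp add: count_list_concat_fib_subst)
qed

lemma pos_diff_shift_fib_word:
  assumes "count_list u La = j" "count_list u Lb = j"
  shows "pos_diff (u @- fib_word) (Suc (j + n)) = int (Suc n)"
proof -
  obtain v t where v: "fib_word = v @- La ## t" "count_list v La = n"
    by (rule fib_word_split_La)
  \<comment> \<open>The \<open>La\<close> at the cut becomes \<open>[La, Lb]\<close>: its first
    letter joins the prefix, its second is the \<open>Lb\<close> sought.\<close>
  let ?v' = "concat (map fib_subst v) @ [La]"
  have v': "fib_word = ?v' @- Lb ## subst_inf fib_subst t"
    using fib_word_eq_subst_shift[OF v(1)] by (simp add: subst_inf_def)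
  have "occ_pos La (u @- fib_word) (Suc (j + n)) = length u + length v"
    using occ_pos_shift_Stream[of La "u @ v" t] assms v by simp
  moreover have "occ_pos Lb (u @- fib_word) (Suc (j + n)) = length u + length ?v'"
    using occ_pos_shift_Stream[of Lb "u @ ?v'" "subst_inf fib_subst t"] assms v(2)
    by (simp add: v'[symmetric] count_list_concat_fib_subst del: shift.simps)
      (simp add: v'[simplified, symmetric])
  ultimately show ?thesis
    using v(2) by (simp add: pos_diff_def count_list_concat_fib_subst)
qed

text \<open>The first \<open>i\<close> blocks hold \<open>i\<close> copies of each letter, so the
  next block holds both occurrences, side by side.\<close>

lemma pos_diff_alternating_shift:
  assumes "i < j"
  shows "pos_diff (concat (replicate j [La, Lb]) @- s) (Suc i) = 1"
proof -
  let ?v = "concat (replicate i [La, Lb])"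
  have c: "count_list ?v La = i" "count_list ?v Lb = i"
    by (induction i) auto
  obtain k where "j = i + Suc k" using assms less_iff_Suc_add by auto
  then have "concat (replicate j [La, Lb]) = ?v @ concat (replicate (Suc k) [La, Lb])"
    by (simp only: replicate_add concat_append)
  then obtain t where w: "concat (replicate j [La, Lb]) @- s = ?v @- La ## Lb ## t"
    by simp
  have "occ_pos La (?v @- La ## Lb ## t) (Suc i) = length ?v"
    using occ_pos_shift_Stream[of La ?v "Lb ## t"] c by simp
  moreover have "occ_pos Lb (?v @- La ## Lb ## t) (Suc i) = length ?v + 1"
    using occ_pos_shift_Stream[of Lb "?v @ [La]" t] c by simp
  ultimately show ?thesis unfolding w by (simp add: pos_diff_def)
qed

theorem theorem4p18:
  fixes j :: nat and u :: "letter list"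
  assumes "j \<ge> 1"
    and "length u = 2 * j"
    and "count_list u La = j"
    and "count_list u Lb = j"
  shows "(\<forall>n>j. pos_diff (u @- fib_word) n = int n - int j) \<and>
    (u = concat (replicate j [La, Lb]) \<longrightarrow>
      (\<forall>n\<in>{1..j}. pos_diff (u @- fib_word) n = 1))"
proof (intro conjI allI impI ballI)
  fix n assume "n > j"
  then obtain k where "n = Suc (j + k)" using less_iff_Suc_add by auto
  then show "pos_diff (u @- fib_word) n = int n - int j"
    using pos_diff_shift_fib_word[OF assms(3,4), of k] by simp
next
  fix n assume u: "u = concat (replicate j [La, Lb])" and n: "n \<in> {1..j}"
  then obtain i where "n = Suc i" "i < j" by (cases n) auto
  then show "pos_diff (u @- fib_word) n = 1"
    unfolding u by (simp only: pos_diff_alternating_shift)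
qed

end
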